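(* Let $W$ be a nonempty set and $\preceq$ a transitive relation on $W$ such that every $\preceq$-decreasing sequence $(w_n)_{n\ge1}\subset W$ is minorized, and let $\phi:W\to\mathbb{R}$ be a $\preceq$-increasing function which is bounded from below. Then (i) for every $w\in\operatorname{dom}S_{\preceq}$ there exists $\overline{w}\in S_{\preceq}(w)$ such that $\phi(w')=\phi(\overline{w})$ for all $w'\in S_{\preceq}(\overline{w})$; (ii) moreover, if $\phi$ is strictly $\preceq$-increasing, then $\preceq$ is antisymmetric and for every $w\in\operatorname{dom}S_{\preceq}$ there exists $\overline{w}\in S_{\preceq}(w)$ such that $S_{\preceq}(\overline{w})\subset\{\overline{w}\}$.
   Context: The relation $\preceq$ is only assumed transitive (not necessarily reflexive). $S_{\preceq}(w):=\{w'\in W\mid w'\preceq w\}$ and $\operatorname{dom}S_{\preceq}:=\{w\in W\mid S_{\preceq}(w)\ne\emptyset\}$. A sequence $(w_n)_{n\ge1}$ is $\preceq$-decreasing if $w_{n+1}\preceq w_n$ for all $n\ge1$; it is minorized if there is $v\in W$ with $v\preceq w_n$ for all $n\ge1$. $\phi$ is $\preceq$-increasing if $w_1\preceq w_2$ implies $\phi(w_1)\le\phi(w_2)$; it is strictly $\preceq$-increasing if $w_1\preceq w_2$ and $w_1\ne w_2$ imply $\phi(w_1)<\phi(w_2)$. *)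

theory Defs
  imports Complex_Main
begin

text \<open>A relation on \<open>W\<close> is represented by a predicate on the ambient type; only its
  restriction to \<open>W\<close> matters. It is not assumed reflexive, so \<open>lower_section W le w\<close> need not
  contain \<open>w\<close> and may be empty.\<close>

definition lower_section :: "'a set \<Rightarrow> ('a \<Rightarrow> 'a \<Rightarrow> bool) \<Rightarrow> 'a \<Rightarrow> 'a set" where
  "lower_section W le w = {w' \<in> W. le w' w}"

definition dom_lower_section :: "'a set \<Rightarrow> ('a \<Rightarrow> 'a \<Rightarrow> bool) \<Rightarrow> 'a set" where
  "dom_lower_section W le = {w \<in> W. lower_section W le w \<noteq> {}}"

text \<open>Sequences are indexed by \<open>n \<ge> 1\<close>; the value at \<open>0\<close> is irrelevant.\<close>

definition decreasing_seq :: "'a set \<Rightarrow> ('a \<Rightarrow> 'a \<Rightarrow> bool) \<Rightarrow> (nat \<Rightarrow> 'a) \<Rightarrow> bool" where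
  "decreasing_seq W le w \<longleftrightarrow> (\<forall>n\<ge>1. w n \<in> W) \<and> (\<forall>n\<ge>1. le (w (Suc n)) (w n))"

definition minorized :: "'a set \<Rightarrow> ('a \<Rightarrow> 'a \<Rightarrow> bool) \<Rightarrow> (nat \<Rightarrow> 'a) \<Rightarrow> bool" where
  "minorized W le w \<longleftrightarrow> (\<exists>v\<in>W. \<forall>n\<ge>1. le v (w n))"

definition strictly_increasing_wrt ::
    "'a set \<Rightarrow> ('a \<Rightarrow> 'a \<Rightarrow> bool) \<Rightarrow> ('a \<Rightarrow> real) \<Rightarrow> bool" where
  "strictly_increasing_wrt W le \<phi> \<longleftrightarrow>
     (\<forall>w1\<in>W. \<forall>w2\<in>W. le w1 w2 \<and> w1 \<noteq> w2 \<longrightarrow> \<phi> w1 < \<phi> w2)"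

end

theory Submission
  imports Defs
begin

text \<open>Unless some point below \<open>w\<close> has an empty lower section, choose a decreasing sequence
  below \<open>w\<close> in which \<open>w\<^bsub>n+1\<^esub>\<close> minimizes \<open>\<phi>\<close> over the lower section of \<open>w\<^bsub>n\<^esub>\<close> up to \<open>1/(n+1)\<close>.
  Everything below a minorant of the sequence lies in all these lower sections, so \<open>\<phi>\<close> cannot
  decrease any further below the minorant.\<close>

lemma near_minimizer:
  fixes \<phi> :: "'a \<Rightarrow> real"
  assumes "A \<noteq> {}" "bdd_below (\<phi> ` A)" "e > 0"
  obtains y where "y \<in> A" "\<And>z. z \<in> A \<Longrightarrow> \<phi> y \<le> \<phi> z + e"
proof -
  have "\<exists>t\<in>\<phi> ` A. t < Inf (\<phi> ` A) + e"
    using assms by (intro cInf_lessD) auto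
  then obtain y where y: "y \<in> A" "\<phi> y < Inf (\<phi> ` A) + e"
    by blast
  have "\<phi> y \<le> \<phi> z + e" if "z \<in> A" for z
    using cINF_lower[OF assms(2) that] y(2) by linarith
  with y(1) show thesis
    by (rule that)
qed

lemma exists_stationary_below:
  fixes \<phi> :: "'a \<Rightarrow> real"
  assumes trans: "transp_on W le"
    and min: "\<And>w. decreasing_seq W le w \<Longrightarrow> minorized W le w"
    and mono: "monotone_on W le (\<le>) \<phi>"
    and bdd: "bdd_below (\<phi> ` W)"
    and w: "w \<in> dom_lower_section W le"
  shows "\<exists>wb\<in>lower_section W le w. \<forall>w'\<in>lower_section W le wb. \<phi> w' = \<phi> wb"
proof (cases "\<exists>x\<in>lower_section W le w. lower_section W le x = {}")
  \<comment> \<open>A point with empty lower section is stationary vacuously.\<close>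
  case True
  then show ?thesis
    by auto
next
  case False
  let ?S = "lower_section W le"
  have wW: "w \<in> W"
    using w by (simp add: dom_lower_section_def)
  \<comment> \<open>The invariant \<open>u n \<in> ?S w\<close> keeps the recursion going: in the
    present case it makes \<open>?S (u n)\<close> nonempty, so a next near-minimizer exists.\<close>
  have "\<exists>u. \<forall>n. u n \<in> ?S w \<and> u (Suc n) \<in> ?S (u n) \<and>
               (\<forall>z\<in>?S (u n). \<phi> (u (Suc n)) \<le> \<phi> z + inverse (real (Suc n)))"
  proof (rule dependent_nat_choice)
    show "\<exists>x. x \<in> ?S w"
      using w by (auto simp: dom_lower_section_def)
  next
    fix x n
    assume x: "x \<in> ?S w"
    have "bdd_below (\<phi> ` ?S x)"
      by (rule bdd_below_mono[OF bdd]) (auto simp: lower_section_def)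
    then obtain y where y: "y \<in> ?S x"
        "\<And>z. z \<in> ?S x \<Longrightarrow> \<phi> y \<le> \<phi> z + inverse (real (Suc n))"
      using False x near_minimizer[of "?S x" \<phi> "inverse (real (Suc n))"] by auto
    moreover have "y \<in> ?S w"
      using x y(1) wW transp_onD[OF trans, of y x w] by (auto simp: lower_section_def)
    ultimately show "\<exists>y. y \<in> ?S w \<and> y \<in> ?S x \<and>
        (\<forall>z\<in>?S x. \<phi> y \<le> \<phi> z + inverse (real (Suc n)))"
      by blast
  qed
  then obtain u where u: "\<And>n. u n \<in> ?S w" "\<And>n. u (Suc n) \<in> ?S (u n)"
      "\<And>n z. z \<in> ?S (u n) \<Longrightarrow> \<phi> (u (Suc n)) \<le> \<phi> z + inverse (real (Suc n))"
    by metis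
  have uW: "u n \<in> W" for n
    using u(1) by (simp add: lower_section_def)
  have "decreasing_seq W le u"
    using u(2) uW by (simp add: decreasing_seq_def lower_section_def)
  then obtain v where v: "v \<in> W" "\<And>n. n \<ge> 1 \<Longrightarrow> le v (u n)"
    using min by (auto simp: minorized_def)
  \<comment> \<open>Without reflexivity this goes through a term of the sequence. Index 1 is the
    first at which \<open>v\<close> is known to be a lower bound, since \<open>minorized\<close>
    ignores index 0.\<close>
  have "v \<in> ?S w"
    using transp_onD[OF trans v(1) uW[of 1] wW] v u(1)[of 1] by (simp add: lower_section_def)
  moreover have "\<phi> v' = \<phi> v" if v': "v' \<in> ?S v" for v'
  proof (rule antisym)
    have v'W: "v' \<in> W" and le: "le v' v"
      using v' by (auto simp: lower_section_def)
    show "\<phi> v' \<le> \<phi> v"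
      using monotone_onD[OF mono v'W v(1) le] .
    \<comment> \<open>By transitivity \<open>v'\<close> competes in the near-minimization over
      \<open>?S (u n)\<close>, while \<open>v\<close> is below the chosen \<open>u (Suc n)\<close>.
      Hence \<open>\<phi> v\<close> exceeds \<open>\<phi> v'\<close> by at most the slack of that
      step, which tends to 0.\<close>
    have "\<phi> v \<le> \<phi> v' + e" if e: "e > 0" for e
    proof -
      obtain n where n: "n \<noteq> 0" "inverse (real n) < e"
        using real_arch_inverse e by auto
      have "v' \<in> ?S (u n)"
        using transp_onD[OF trans v'W v(1) uW le] v(2) v'W n(1)
        by (simp add: lower_section_def)
      then have "\<phi> (u (Suc n)) \<le> \<phi> v' + inverse (real (Suc n))"
        by (rule u(3))
      moreover have "\<phi> v \<le> \<phi> (u (Suc n))"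
        using monotone_onD[OF mono v(1) uW v(2)] by simp
      moreover have "inverse (real (Suc n)) \<le> inverse (real n)"
        using n(1) by (intro le_imp_inverse_le) auto
      ultimately show ?thesis
        using n(2) by linarith
    qed
    then show "\<phi> v \<le> \<phi> v'"
      by (rule field_le_epsilon)
  qed
  ultimately show ?thesis
    by blast
qed

theorem theorem3p2:
  fixes W :: "'a set" and le :: "'a \<Rightarrow> 'a \<Rightarrow> bool" and \<phi> :: "'a \<Rightarrow> real"
  assumes "W \<noteq> {}"
    and "transp_on W le"
    and "\<And>w. decreasing_seq W le w \<Longrightarrow> minorized W le w"
    and "monotone_on W le (\<le>) \<phi>"
    and "bdd_below (\<phi> ` W)"
  shows "(\<forall>w\<in>dom_lower_section W le. \<exists>wb\<in>lower_section W le w.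
            \<forall>w'\<in>lower_section W le wb. \<phi> w' = \<phi> wb) \<and>
         (strictly_increasing_wrt W le \<phi> \<longrightarrow>
            antisymp_on W le \<and>
            (\<forall>w\<in>dom_lower_section W le. \<exists>wb\<in>lower_section W le w.
               lower_section W le wb \<subseteq> {wb}))"
proof (intro conjI impI)
  show stationary: "\<forall>w\<in>dom_lower_section W le. \<exists>wb\<in>lower_section W le w.
      \<forall>w'\<in>lower_section W le wb. \<phi> w' = \<phi> wb"
    using exists_stationary_below[OF assms(2-5)] by blast
  assume strict: "strictly_increasing_wrt W le \<phi>"
  show "antisymp_on W le"
  proof (rule antisymp_onI, rule ccontr)
    fix x y
    assume "x \<in> W" "y \<in> W" "le x y" "le y x" "x \<noteq> y"
    then have "\<phi> x < \<phi> y" "\<phi> y < \<phi> x"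
      using strict by (auto simp: strictly_increasing_wrt_def)
    then show False
      by simp
  qed
  \<comment> \<open>A point below \<open>wb\<close> and different from it would have a strictly
    smaller value of \<open>\<phi>\<close>, contradicting stationarity.\<close>
  have "lower_section W le wb \<subseteq> {wb}"
    if "wb \<in> W" "\<forall>w'\<in>lower_section W le wb. \<phi> w' = \<phi> wb" for wb
    using that strict by (force simp: strictly_increasing_wrt_def lower_section_def)
  moreover have "lower_section W le w \<subseteq> W" for w
    by (auto simp: lower_section_def)
  ultimately show "\<forall>w\<in>dom_lower_section W le. \<exists>wb\<in>lower_section W le w.
      lower_section W le wb \<subseteq> {wb}"
    using stationary by (meson subsetD)
qed

end
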